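(* For $\theta\in\mathbb{R}$ let $X$ and $Y$ be independent real random variables with $X\sim p(|x-\theta|^2)$ (Lebesgue density on $\mathbb{R}$) and $Y\sim U(\theta-1,\theta+1)$, and consider the estimation of the density $\frac12\,\mathbb{I}_{(\theta-1,\theta+1)}(y)$ of $Y$ under the $L_1$ loss $L(\theta,\hat q)=\int_{\mathbb{R}}\big|\frac12\mathbb{I}_{(\theta-1,\theta+1)}(y)-\hat q(y)\big|\,dy$. Then, among the predictive densities $\hat q_c(y;X)=\frac{1}{2c}\,\mathbb{I}_{(X-c,X+c)}(y)$, $c>0$, either one of the following conditions is sufficient for the plug-in choice $\hat q_1$ to be optimal: (i) $\mathbb{E}_0\big(|X|\,\big|\,|X|\le 2\big)\le 1$ and $p(s^2)\ge p\big((s+2)^2\big)$ for all $s>0$; (ii) $p$ is non-increasing on $(0,\infty)$.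
   Context: The risk is $R(\theta,\hat q_c)=\mathbb{E}_\theta\,L(\theta,\hat q_c(\cdot;X))$ with $X\sim p(|x-\theta|^2)$; for each $c$ it does not depend on $\theta$. Optimality of $\hat q_1$ means $R(\theta,\hat q_1)\le R(\theta,\hat q_c)$ for all $c>0$ (and all $\theta$). $\mathbb{E}_0$ denotes expectation when $\theta=0$. *)

theory Defs
  imports "HOL-Probability.Probability"
begin

definition target_density :: "real \<Rightarrow> real \<Rightarrow> real" where
  "target_density \<theta> y = 1 / 2 * indicator {\<theta> - 1<..<\<theta> + 1} y"

definition pred_density :: "real \<Rightarrow> real \<Rightarrow> real \<Rightarrow> real" where
  "pred_density c x y = 1 / (2 * c) * indicator {x - c<..<x + c} y"

definition L1_loss :: "real \<Rightarrow> (real \<Rightarrow> real) \<Rightarrow> real" where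
  "L1_loss \<theta> q = (LINT y|lborel. \<bar>target_density \<theta> y - q y\<bar>)"

text \<open>
  \<open>P \<theta>\<close> is the underlying probability measure under the parameter \<open>\<theta>\<close>; an estimator \<open>q\<close> maps the
  observed value of \<open>X\<close> to a function of \<open>y\<close>.
\<close>

definition risk ::
  "(real \<Rightarrow> 'a measure) \<Rightarrow> ('a \<Rightarrow> real) \<Rightarrow> real \<Rightarrow> (real \<Rightarrow> real \<Rightarrow> real) \<Rightarrow> real" where
  "risk P X \<theta> q = (LINT \<omega>|P \<theta>. L1_loss \<theta> (q (X \<omega>)))"

definition optimal_scale :: "(real \<Rightarrow> 'a measure) \<Rightarrow> ('a \<Rightarrow> real) \<Rightarrow> real \<Rightarrow> bool" where
  "optimal_scale P X c0 \<longleftrightarrow>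
     c0 > 0 \<and> (\<forall>c>0. \<forall>\<theta>. risk P X \<theta> (pred_density c0) \<le> risk P X \<theta> (pred_density c))"

text \<open>
  Elementary conditional expectation given an event: \<^const>\<open>uniform_measure\<close> \<open>M A\<close> is \<open>M\<close> conditioned
  on \<open>A\<close>. It is meaningful for \<open>A\<close> of positive probability, and is 0 if \<open>A\<close> is a null set.
\<close>

definition cond_expect_event :: "'a measure \<Rightarrow> ('a \<Rightarrow> real) \<Rightarrow> 'a set \<Rightarrow> real" where
  "cond_expect_event M f A = (LINT \<omega>|uniform_measure M A. f \<omega>)"

end

theory Submission
  imports Defs
begin

text \<open>
  Write \<open>T = \<bar>X - \<theta>\<bar>\<close>. The \<open>L\<^sub>1\<close> distance of two uniform densities is
  \<open>2 - 2\<integral>min\<close>, so the risk of \<open>q\<^sub>c\<close> is \<open>2 - E (overlap c T) / max 1 c\<close>, where \<open>overlap c t\<close> is the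
  length of the intersection of intervals of radii \<open>1\<close> and \<open>c\<close> whose centres are \<open>t\<close> apart. For \<open>c \<le> 1\<close> the overlap
  is at most that for \<open>c = 1\<close>. For \<open>c > 1\<close> the excess \<open>overlap c t - overlap 1 t\<close> is the length of
  \<open>{s \<in> (1, c). \<bar>s - t\<bar> < 1}\<close>, so by Fubini its mean is the integral over \<open>s \<in> (1, c)\<close> of the
  probability of \<open>s - 1 < T < s + 1\<close>. Folding by shifts of length 2 bounds that probability by the one of
  \<open>T < 2\<close>, and the latter is at most \<open>E (2 - T)\<^sup>+ = E (overlap 1 T)\<close> exactly when
  \<open>E ((1 - T) 1\<^bsub>T \<le> 2\<^esub>) \<ge> 0\<close>. A non-increasing density satisfies both requirements.
\<close>

section \<open>The loss in terms of overlapping intervals\<close>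

definition overlap :: "real \<Rightarrow> real \<Rightarrow> real" where
  "overlap c t = max 0 (min 1 (t + c) - max (- 1) (t - c))"

lemma borel_measurable_overlap [measurable]: "overlap c \<in> borel_measurable borel"
  unfolding overlap_def[abs_def] by measurable

lemma overlap_nonneg: "0 \<le> overlap c t"
  by (simp add: overlap_def)

lemma overlap_le_2: "overlap c t \<le> 2"
  by (auto simp: overlap_def)

lemma emeasure_lborel_Ioo_max: "emeasure lborel {a<..<b::real} = ennreal (max 0 (b - a))"
  by (cases "a \<le> b") (auto simp: max_def)

lemma measure_lborel_Ioo_max: "measure lborel {a<..<b::real} = max 0 (b - a)"
  by (cases "a \<le> b") (auto simp: max_def)

lemma L1_loss_pred_density:
  assumes c: "c > 0"
  shows "L1_loss \<theta> (pred_density c x) = 2 - min 1 (1 / c) * overlap c \<bar>x - \<theta>\<bar>"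
proof -
  let ?I = "{\<theta> - 1<..<\<theta> + 1}" and ?J = "{x - c<..<x + c}"
  let ?m = "min (1 / 2) (1 / (2 * c))"
  \<comment> \<open>This is \<open>\<bar>a - b\<bar> = a + b - 2 * min a b\<close>; the pointwise
    minimum of the two densities is the smaller height \<open>?m\<close> on the intersection of
    \<open>?I\<close> and \<open>?J\<close>.\<close>
  have eq: "\<bar>target_density \<theta> y - pred_density c x y\<bar> =
      1 / 2 * indicator ?I y + 1 / (2 * c) * indicator ?J y
      - 2 * ?m * indicator {max (\<theta> - 1) (x - c)<..<min (\<theta> + 1) (x + c)} y" for y
    using c by (auto simp: target_density_def pred_density_def indicator_def min_def abs_if)
  have int: "integrable lborel (\<lambda>y. k * indicator {a<..<b} y :: real)" for k a b :: real
    by (intro integrable_mult_right integrable_real_indicator) (auto simp: emeasure_lborel_Ioo_max)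
  have "L1_loss \<theta> (pred_density c x) =
      1 / 2 * measure lborel ?I + 1 / (2 * c) * measure lborel ?J
      - 2 * ?m * measure lborel {max (\<theta> - 1) (x - c)<..<min (\<theta> + 1) (x + c)}"
    unfolding L1_loss_def eq
    using int[of "1 / 2" "\<theta> - 1" "\<theta> + 1"] int[of "1 / (2 * c)" "x - c" "x + c"]
      int[of "2 * ?m" "max (\<theta> - 1) (x - c)" "min (\<theta> + 1) (x + c)"]
    by (simp only: Bochner_Integration.integral_diff Bochner_Integration.integral_add
          Bochner_Integration.integrable_add integral_mult_right_zero integral_indicator) simp
  also have "1 / 2 * measure lborel ?I + 1 / (2 * c) * measure lborel ?J = 2"
    using c by (simp add: field_simps)
  also have "2 * ?m = min 1 (1 / c)"
    using c by (auto simp: min_def field_simps)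
  \<comment> \<open>Translation by \<open>\<theta>\<close>, and reflection when
    \<open>x < \<theta>\<close>, leave the length of the intersection unchanged.\<close>
  also have "measure lborel {max (\<theta> - 1) (x - c)<..<min (\<theta> + 1) (x + c)} = overlap c \<bar>x - \<theta>\<bar>"
    using c unfolding measure_lborel_Ioo_max overlap_def by (simp add: min_def max_def abs_if)
  finally show ?thesis .
qed

lemma overlap_mono_scale: "c \<le> d \<Longrightarrow> overlap c t \<le> overlap d t"
  by (auto simp: overlap_def)

section \<open>Integrals over sliding windows\<close>

text \<open>As the radius \<open>s\<close> grows from 1 to \<open>c\<close>, the right end
  \<open>t + s\<close> is already beyond 1, so only the left end \<open>t - s\<close> adds to the
  overlap, at unit rate while it lies in (-1, 1).\<close>

lemma nn_integral_indicator_window: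
  assumes "c \<ge> 1" "t \<ge> 0"
  shows "(\<integral>\<^sup>+s. indicator {1<..<c} s * indicator {s - 1<..<s + 1} t \<partial>lborel)
           = ennreal (overlap c t - overlap 1 t)"
proof -
  have "(\<integral>\<^sup>+s. indicator {1<..<c} s * indicator {s - 1<..<s + 1} t \<partial>lborel)
      = (\<integral>\<^sup>+s. indicator {max 1 (t - 1)<..<min c (t + 1)} s \<partial>lborel)"
    by (intro nn_integral_cong) (auto simp: indicator_def)
  also have "\<dots> = ennreal (max 0 (min c (t + 1) - max 1 (t - 1)))"
    by (simp add: emeasure_lborel_Ioo_max)
  also have "max 0 (min c (t + 1) - max 1 (t - 1)) = overlap c t - overlap 1 t"
    using assms by (simp add: overlap_def min_def max_def)
  finally show ?thesis .
qed

text \<open>Evenness moves integrals against the law of \<open>\<bar>Z\<bar>\<close> to the positive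
  half-line, where the shift hypothesis speaks.\<close>

lemma nn_integral_abs:
  fixes h :: "real \<Rightarrow> ennreal"
  assumes [measurable]: "h \<in> borel_measurable borel"
  shows "(\<integral>\<^sup>+x. h \<bar>x\<bar> \<partial>lborel) = 2 * (\<integral>\<^sup>+x. h x * indicator {0<..} x \<partial>lborel)"
proof -
  have "(\<integral>\<^sup>+x. h \<bar>x\<bar> \<partial>lborel)
      = (\<integral>\<^sup>+x. h x * indicator {0<..} x + h (- x) * indicator {..<0} x \<partial>lborel)"
    using AE_lborel_singleton[of "0::real"]
    by (intro nn_integral_cong_AE) (auto elim!: eventually_mono simp: indicator_def abs_if)
  also have "\<dots> = (\<integral>\<^sup>+x. h x * indicator {0<..} x \<partial>lborel)
      + (\<integral>\<^sup>+x. h (- x) * indicator {..<0} x \<partial>lborel)"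
    by (rule nn_integral_add) auto
  also have "(\<integral>\<^sup>+x. h (- x) * indicator {..<0} x \<partial>lborel)
      = (\<integral>\<^sup>+x. h x * indicator {0<..} x \<partial>lborel)"
    by (subst nn_integral_real_affine[where c = "- 1" and t = 0])
       (auto simp: indicator_def intro!: nn_integral_cong)
  finally show ?thesis
    by (simp add: mult_2)
qed

text \<open>The part of the moved window that sticks out of the old one, pulled back by 2, lands
  exactly in the part of the old window that was vacated. The two pieces therefore stay disjoint
  inside the old window.\<close>

lemma nn_integral_window_shift:
  fixes g :: "real \<Rightarrow> ennreal"
  assumes [measurable]: "g \<in> borel_measurable borel"
    and shift: "\<And>x. x > 0 \<Longrightarrow> g (x + 2) \<le> g x"
    and s: "s \<ge> 1" and d: "0 \<le> d" "d \<le> 2"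
  shows "(\<integral>\<^sup>+x. g x * indicator {s + d - 1<..<s + d + 1} x \<partial>lborel)
           \<le> (\<integral>\<^sup>+x. g x * indicator {s - 1<..<s + 1} x \<partial>lborel)"
proof -
  \<comment> \<open>The last indicator matters only for \<open>d = 2\<close>, where it removes the
    point \<open>s + 1\<close>, which the open window omits.\<close>
  have "(\<integral>\<^sup>+x. g x * indicator {s + d - 1<..<s + d + 1} x \<partial>lborel)
      = (\<integral>\<^sup>+x. g x * indicator {s + d - 1<..<s + 1} x
              + g x * indicator {s + 1..<s + d + 1} x * indicator {s + d - 1<..} x \<partial>lborel)"
    using d by (intro nn_integral_cong) (auto simp: indicator_def)
  also have "\<dots> \<le> (\<integral>\<^sup>+x. g x * indicator {s + d - 1<..<s + 1} x
              + g x * indicator {s + 1..<s + d + 1} x \<partial>lborel)"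
    by (intro nn_integral_mono) (auto simp: indicator_def)
  also have "\<dots> = (\<integral>\<^sup>+x. g x * indicator {s + d - 1<..<s + 1} x \<partial>lborel)
      + (\<integral>\<^sup>+x. g x * indicator {s + 1..<s + d + 1} x \<partial>lborel)"
    by (rule nn_integral_add) auto
  also have "(\<integral>\<^sup>+x. g x * indicator {s + 1..<s + d + 1} x \<partial>lborel)
      = (\<integral>\<^sup>+x. g (x + 2) * indicator {s - 1..<s + d - 1} x \<partial>lborel)"
    by (subst nn_integral_real_affine[where c = 1 and t = 2])
       (auto simp: indicator_def add.commute intro!: nn_integral_cong)
  \<comment> \<open>The endpoint \<open>s - 1\<close> may be 0, where \<open>shift\<close> says
    nothing; it is discarded as a null set.\<close>
  also have "\<dots> \<le> (\<integral>\<^sup>+x. g x * indicator {s - 1<..<s + d - 1} x \<partial>lborel)"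
    using AE_lborel_singleton[of "s - 1"] s
    by (intro nn_integral_mono_AE) (auto elim!: eventually_mono simp: indicator_def intro!: shift)
  also have "(\<integral>\<^sup>+x. g x * indicator {s + d - 1<..<s + 1} x \<partial>lborel)
        + (\<integral>\<^sup>+x. g x * indicator {s - 1<..<s + d - 1} x \<partial>lborel)
      = (\<integral>\<^sup>+x. g x * indicator {s + d - 1<..<s + 1} x
              + g x * indicator {s - 1<..<s + d - 1} x \<partial>lborel)"
    by (rule nn_integral_add[symmetric]) auto
  also have "\<dots> \<le> (\<integral>\<^sup>+x. g x * indicator {s - 1<..<s + 1} x \<partial>lborel)"
    using d by (intro nn_integral_mono) (auto simp: indicator_def)
  finally show ?thesis
    by (simp add: add_left_mono)
qed

lemma nn_integral_window_le:
  fixes g :: "real \<Rightarrow> ennreal"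
  assumes g: "g \<in> borel_measurable borel"
    and shift: "\<And>x. x > 0 \<Longrightarrow> g (x + 2) \<le> g x"
    and s: "s \<ge> 1"
  shows "(\<integral>\<^sup>+x. g x * indicator {s - 1<..<s + 1} x \<partial>lborel)
           \<le> (\<integral>\<^sup>+x. g x * indicator {0<..<2} x \<partial>lborel)"
proof -
  obtain n :: nat where "s \<le> real n"
    using real_arch_simple[of s] by blast
  \<comment> \<open>A bound of this form lets an induction in steps of 2 end at
    \<open>s = 1\<close>, whose window is (0, 2).\<close>
  then have "s \<le> real (1 + 2 * n)"
    by simp
  then show ?thesis
    using s
  proof (induction n arbitrary: s)
    case 0
    then have "s = 1" by simp
    then show ?case by simp
  next
    case (Suc n)
    \<comment> \<open>The step back has length 2, except that it is cut short so as not to pass 1.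
      Hence the shift lemma admits every \<open>d\<close> from 0 to 2.\<close>
    define r where "r = max 1 (s - 2)"
    have r: "r \<ge> 1" "r \<le> 1 + 2 * n" "0 \<le> s - r" "s - r \<le> 2"
      using Suc.prems by (auto simp: r_def)
    have "(\<integral>\<^sup>+x. g x * indicator {s - 1<..<s + 1} x \<partial>lborel)
        \<le> (\<integral>\<^sup>+x. g x * indicator {r - 1<..<r + 1} x \<partial>lborel)"
      using nn_integral_window_shift[OF g shift r(1,3,4)] by simp
    also have "\<dots> \<le> (\<integral>\<^sup>+x. g x * indicator {0<..<2} x \<partial>lborel)"
      using Suc.IH[OF r(2,1)] .
    finally show ?case .
  qed
qed

section \<open>Expected overlap and risk for one parameter value\<close>

context prob_space
begin

lemma nn_integral_abs_window_le:
  fixes Z :: "'a \<Rightarrow> real" and p :: "real \<Rightarrow> real"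
  assumes Z: "distributed M lborel Z (\<lambda>x. ennreal (p (x\<^sup>2)))"
    and shift: "\<And>x. x > 0 \<Longrightarrow> p ((x + 2)\<^sup>2) \<le> p (x\<^sup>2)"
    and s: "s \<ge> 1"
  shows "(\<integral>\<^sup>+\<omega>. indicator {s - 1<..<s + 1} \<bar>Z \<omega>\<bar> \<partial>M) \<le> (\<integral>\<^sup>+\<omega>. indicator {0<..<2} \<bar>Z \<omega>\<bar> \<partial>M)"
proof -
  have [measurable]: "(\<lambda>x. ennreal (p (x\<^sup>2))) \<in> borel_measurable borel"
    using distributed_borel_measurable[OF Z] by simp
  have eq: "(\<integral>\<^sup>+\<omega>. indicator {a<..<b} \<bar>Z \<omega>\<bar> \<partial>M)
      = 2 * (\<integral>\<^sup>+x. ennreal (p (x\<^sup>2)) * indicator {a<..<b} x \<partial>lborel)" if "a \<ge> 0" for a b :: real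
  proof -
    have "(\<integral>\<^sup>+\<omega>. indicator {a<..<b} \<bar>Z \<omega>\<bar> \<partial>M)
        = (\<integral>\<^sup>+x. ennreal (p (x\<^sup>2)) * indicator {a<..<b} \<bar>x\<bar> \<partial>lborel)"
      by (rule distributed_nn_integral[OF Z, symmetric]) simp
    also have "\<dots> = 2 * (\<integral>\<^sup>+x. ennreal (p (x\<^sup>2)) * indicator {a<..<b} x * indicator {0<..} x \<partial>lborel)"
      using nn_integral_abs[of "\<lambda>x. ennreal (p (x\<^sup>2)) * indicator {a<..<b} x"] by simp
    also have "(\<integral>\<^sup>+x. ennreal (p (x\<^sup>2)) * indicator {a<..<b} x * indicator {0<..} x \<partial>lborel)
        = (\<integral>\<^sup>+x. ennreal (p (x\<^sup>2)) * indicator {a<..<b} x \<partial>lborel)"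
      using that by (intro nn_integral_cong) (auto simp: indicator_def)
    finally show ?thesis .
  qed
  have "(\<integral>\<^sup>+x. ennreal (p (x\<^sup>2)) * indicator {s - 1<..<s + 1} x \<partial>lborel)
      \<le> (\<integral>\<^sup>+x. ennreal (p (x\<^sup>2)) * indicator {0<..<2} x \<partial>lborel)"
    using s by (intro nn_integral_window_le) (auto intro!: ennreal_leI shift)
  then show ?thesis
    using s by (simp add: eq mult_left_mono)
qed

lemma integrable_overlap:
  assumes [measurable]: "Z \<in> borel_measurable M"
  shows "integrable M (\<lambda>\<omega>. overlap c \<bar>Z \<omega>\<bar>)"
  using overlap_nonneg overlap_le_2 by (intro integrable_const_bound[where B = 2]) auto

lemma integrable_truncated_1_minus:
  fixes Z :: "'a \<Rightarrow> real"
  assumes [measurable]: "Z \<in> borel_measurable M"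
  shows "integrable M (\<lambda>\<omega>. (1 - \<bar>Z \<omega>\<bar>) * indicator {..2} \<bar>Z \<omega>\<bar>)"
  by (intro integrable_const_bound[where B = 2] AE_I2) (auto split: split_indicator)

lemma expectation_overlap_le:
  fixes Z :: "'a \<Rightarrow> real" and p :: "real \<Rightarrow> real"
  assumes Z: "distributed M lborel Z (\<lambda>x. ennreal (p (x\<^sup>2)))"
    and shift: "\<And>x. x > 0 \<Longrightarrow> p ((x + 2)\<^sup>2) \<le> p (x\<^sup>2)"
    and mean: "0 \<le> expectation (\<lambda>\<omega>. (1 - \<bar>Z \<omega>\<bar>) * indicator {..2} \<bar>Z \<omega>\<bar>)"
    and c: "c > 1"
  shows "expectation (\<lambda>\<omega>. overlap c \<bar>Z \<omega>\<bar>) \<le> c * expectation (\<lambda>\<omega>. overlap 1 \<bar>Z \<omega>\<bar>)"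
proof -
  have [measurable]: "Z \<in> borel_measurable M"
    using distributed_measurable[OF Z] by simp
  interpret pair_sigma_finite M "lborel :: real measure" ..
  \<comment> \<open>The event is closed at 2 to match the conditioning event of the hypothesis; the
    open window (0, 2) enters by inclusion.\<close>
  define A where "A = prob {\<omega> \<in> space M. \<bar>Z \<omega>\<bar> \<le> 2}"
  have A_eq: "expectation (\<lambda>\<omega>. indicator {..2} \<bar>Z \<omega>\<bar>) = A"
  proof -
    have "expectation (\<lambda>\<omega>. indicator {..2} \<bar>Z \<omega>\<bar>)
        = expectation (indicator {\<omega> \<in> space M. \<bar>Z \<omega>\<bar> \<le> 2})"
      by (intro Bochner_Integration.integral_cong) (auto simp: indicator_def)
    also have "\<dots> = A"
      by (simp add: A_def)
    finally show ?thesis .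
  qed
  have A_le: "(\<integral>\<^sup>+\<omega>. indicator {0<..<2} \<bar>Z \<omega>\<bar> \<partial>M) \<le> ennreal A"
  proof -
    have "(\<integral>\<^sup>+\<omega>. indicator {0<..<2} \<bar>Z \<omega>\<bar> \<partial>M) \<le> (\<integral>\<^sup>+\<omega>. indicator {\<omega> \<in> space M. \<bar>Z \<omega>\<bar> \<le> 2} \<omega> \<partial>M)"
      by (intro nn_integral_mono) (auto simp: indicator_def)
    also have "\<dots> = ennreal A"
      by (simp add: A_def emeasure_eq_measure)
    finally show ?thesis .
  qed
  have int: "integrable M (\<lambda>\<omega>. overlap b \<bar>Z \<omega>\<bar>)" for b
    by (rule integrable_overlap) simp
  have "ennreal (expectation (\<lambda>\<omega>. overlap c \<bar>Z \<omega>\<bar> - overlap 1 \<bar>Z \<omega>\<bar>))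
      = (\<integral>\<^sup>+\<omega>. ennreal (overlap c \<bar>Z \<omega>\<bar> - overlap 1 \<bar>Z \<omega>\<bar>) \<partial>M)"
    using int c by (intro nn_integral_eq_integral[symmetric] AE_I2) (auto intro!: overlap_mono_scale)
  also have "\<dots> = (\<integral>\<^sup>+\<omega>. \<integral>\<^sup>+s. indicator {1<..<c} s * indicator {s - 1<..<s + 1} \<bar>Z \<omega>\<bar> \<partial>lborel \<partial>M)"
    using c by (simp add: nn_integral_indicator_window)
  \<comment> \<open>The window moves with \<open>s\<close>, so its indicator is unfolded into a
    condition whose joint measurability in \<open>s\<close> and \<open>\<omega>\<close> can be
    checked.\<close>
  also have "\<dots> = (\<integral>\<^sup>+s. \<integral>\<^sup>+\<omega>. indicator {1<..<c} s * indicator {s - 1<..<s + 1} \<bar>Z \<omega>\<bar> \<partial>M \<partial>lborel)"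
    unfolding indicator_def by (rule Fubini'[symmetric]) simp
  also have "\<dots> \<le> (\<integral>\<^sup>+s. ennreal A * indicator {1<..<c} s \<partial>lborel)"
  proof (intro nn_integral_mono)
    fix s :: real
    show "(\<integral>\<^sup>+\<omega>. indicator {1<..<c} s * indicator {s - 1<..<s + 1} \<bar>Z \<omega>\<bar> \<partial>M)
        \<le> ennreal A * indicator {1<..<c} s"
    proof (cases "s \<in> {1<..<c}")
      case True
      then have "(\<integral>\<^sup>+\<omega>. indicator {s - 1<..<s + 1} \<bar>Z \<omega>\<bar> \<partial>M) \<le> ennreal A"
        using nn_integral_abs_window_le[OF Z shift, of s] A_le by (auto intro: order_trans)
      with True show ?thesis by simp
    qed simp
  qed
  also have "\<dots> = ennreal (A * (c - 1))"
    using c by (subst nn_integral_cmult) (auto simp: A_def ennreal_mult)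
  finally have "expectation (\<lambda>\<omega>. overlap c \<bar>Z \<omega>\<bar> - overlap 1 \<bar>Z \<omega>\<bar>) \<le> A * (c - 1)"
    using c by (simp add: A_def)
  then have excess: "expectation (\<lambda>\<omega>. overlap c \<bar>Z \<omega>\<bar>) - expectation (\<lambda>\<omega>. overlap 1 \<bar>Z \<omega>\<bar>) \<le> A * (c - 1)"
    using int by simp
  \<comment> \<open>\<open>overlap 1 t\<close> is the positive part of \<open>2 - t\<close>, split
    on \<open>t \<le> 2\<close> as \<open>(1 - t) + 1\<close>: the first summand is controlled by
    \<open>mean\<close>, the second has expectation \<open>A\<close>.\<close>
  have "expectation (\<lambda>\<omega>. overlap 1 \<bar>Z \<omega>\<bar>)
      = expectation (\<lambda>\<omega>. (1 - \<bar>Z \<omega>\<bar>) * indicator {..2} \<bar>Z \<omega>\<bar> + indicator {..2} \<bar>Z \<omega>\<bar>)"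
    by (intro Bochner_Integration.integral_cong) (auto simp: overlap_def split: split_indicator)
  also have "\<dots> = expectation (\<lambda>\<omega>. (1 - \<bar>Z \<omega>\<bar>) * indicator {..2} \<bar>Z \<omega>\<bar>) + A"
    unfolding A_eq[symmetric]
    by (intro Bochner_Integration.integral_add integrable_truncated_1_minus integrable_const_bound[where B = 1] AE_I2)
       (auto split: split_indicator)
  finally have "A \<le> expectation (\<lambda>\<omega>. overlap 1 \<bar>Z \<omega>\<bar>)"
    using mean by simp
  \<comment> \<open>With \<open>B\<close> the expected overlap at scale 1, the expected overlap at
    scale \<open>c\<close> is at most
    \<open>B + A * (c - 1) \<le> B + B * (c - 1) = c * B\<close>.\<close>
  then have "A * (c - 1) \<le> expectation (\<lambda>\<omega>. overlap 1 \<bar>Z \<omega>\<bar>) * (c - 1)"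
    using c by (intro mult_right_mono) auto
  then show ?thesis
    using excess by (simp add: algebra_simps)
qed

lemma risk_le:
  fixes X :: "'a \<Rightarrow> real" and p :: "real \<Rightarrow> real"
  assumes X: "distributed M lborel (\<lambda>\<omega>. X \<omega> - \<theta>) (\<lambda>x. ennreal (p (x\<^sup>2)))"
    and shift: "\<And>x. x > 0 \<Longrightarrow> p ((x + 2)\<^sup>2) \<le> p (x\<^sup>2)"
    and mean: "0 \<le> expectation (\<lambda>\<omega>. (1 - \<bar>X \<omega> - \<theta>\<bar>) * indicator {..2} \<bar>X \<omega> - \<theta>\<bar>)"
    and c: "c > 0"
  shows "expectation (\<lambda>\<omega>. L1_loss \<theta> (pred_density 1 (X \<omega>)))
           \<le> expectation (\<lambda>\<omega>. L1_loss \<theta> (pred_density c (X \<omega>)))"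
proof -
  have [measurable]: "(\<lambda>\<omega>. X \<omega> - \<theta>) \<in> borel_measurable M"
    using distributed_measurable[OF X] by simp
  have int: "integrable M (\<lambda>\<omega>. overlap b \<bar>X \<omega> - \<theta>\<bar>)" for b
    by (rule integrable_overlap) simp
  have eq: "expectation (\<lambda>\<omega>. L1_loss \<theta> (pred_density b (X \<omega>)))
      = 2 - min 1 (1 / b) * expectation (\<lambda>\<omega>. overlap b \<bar>X \<omega> - \<theta>\<bar>)" if "b > 0" for b
    using int[of b] by (simp add: L1_loss_pred_density that prob_space)
  \<comment> \<open>By \<open>eq\<close> this is the risk comparison. The factor is 1 for
    \<open>c \<le> 1\<close>, where monotonicity in the scale suffices, and \<open>1 / c\<close>
    beyond.\<close>
  have "min 1 (1 / c) * expectation (\<lambda>\<omega>. overlap c \<bar>X \<omega> - \<theta>\<bar>) \<le> expectation (\<lambda>\<omega>. overlap 1 \<bar>X \<omega> - \<theta>\<bar>)"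
  proof (cases "c \<le> 1")
    case True
    then have "expectation (\<lambda>\<omega>. overlap c \<bar>X \<omega> - \<theta>\<bar>) \<le> expectation (\<lambda>\<omega>. overlap 1 \<bar>X \<omega> - \<theta>\<bar>)"
      by (intro integral_mono int overlap_mono_scale)
    with True c show ?thesis by (simp add: min_def)
  next
    case False
    then show ?thesis
      using expectation_overlap_le[OF X shift mean, of c] by (simp add: min_def field_simps)
  qed
  then show ?thesis
    using c by (simp add: eq)
qed

end

section \<open>Sign of the truncated mean under each condition\<close>

text \<open>Multiplying the conditional mean by the probability of the event turns the bound by 1
  into an inequality between plain expectations.\<close>

lemma (in prob_space) truncated_mean_nonneg_of_cond_expect:
  fixes X :: "'a \<Rightarrow> real"
  assumes [measurable]: "X \<in> borel_measurable M"
    and le: "cond_expect_event M (\<lambda>\<omega>. \<bar>X \<omega>\<bar>) {\<omega> \<in> space M. \<bar>X \<omega>\<bar> \<le> 2} \<le> 1"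
  shows "0 \<le> expectation (\<lambda>\<omega>. (1 - \<bar>X \<omega>\<bar>) * indicator {..2} \<bar>X \<omega>\<bar>)"
proof -
  let ?E = "{\<omega> \<in> space M. \<bar>X \<omega>\<bar> \<le> 2}"
  have "expectation (\<lambda>\<omega>. (1 - \<bar>X \<omega>\<bar>) * indicator {..2} \<bar>X \<omega>\<bar>)
      = expectation (\<lambda>\<omega>. indicator ?E \<omega> - indicator ?E \<omega> * \<bar>X \<omega>\<bar>)"
    by (intro Bochner_Integration.integral_cong) (auto simp: indicator_def)
  also have "\<dots> = prob ?E - expectation (\<lambda>\<omega>. indicator ?E \<omega> * \<bar>X \<omega>\<bar>)"
    by (subst Bochner_Integration.integral_diff)
       (auto intro!: integrable_const_bound[where B = 2] simp: indicator_def)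
  finally have eq: "expectation (\<lambda>\<omega>. (1 - \<bar>X \<omega>\<bar>) * indicator {..2} \<bar>X \<omega>\<bar>)
      = prob ?E - expectation (\<lambda>\<omega>. indicator ?E \<omega> * \<bar>X \<omega>\<bar>)" .
  show ?thesis
  proof (cases "prob ?E = 0")
    \<comment> \<open>There is no dividing by \<open>prob ?E\<close> here, but both terms of
      \<open>eq\<close> vanish.\<close>
    case True
    then have "AE \<omega> in M. \<omega> \<notin> ?E"
      by (subst (asm) prob_eq_0) auto
    then have "expectation (\<lambda>\<omega>. indicator ?E \<omega> * \<bar>X \<omega>\<bar>) = 0"
      by (intro integral_eq_zero_AE) (auto elim!: eventually_mono simp: indicator_def)
    with True eq show ?thesis by simp
  next
    case False
    then have pos: "prob ?E > 0"
      by (simp add: order.not_eq_order_implies_strict)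
    \<comment> \<open>The extended quotient in \<open>uniform_measure\<close> is replaced by a
      real-valued density, so that the Bochner integral can be transferred to
      \<open>M\<close>.\<close>
    have "uniform_measure M ?E = density M (\<lambda>\<omega>. ennreal (indicator ?E \<omega> / prob ?E))"
      unfolding uniform_measure_def using pos
      by (intro density_cong) (auto simp: emeasure_eq_measure indicator_def divide_ennreal simp flip: ennreal_1)
    then have "cond_expect_event M (\<lambda>\<omega>. \<bar>X \<omega>\<bar>) ?E
        = expectation (\<lambda>\<omega>. indicator ?E \<omega> / prob ?E * \<bar>X \<omega>\<bar>)"
      unfolding cond_expect_event_def
      by (simp only:) (rule integral_real_density, auto)
    also have "\<dots> = expectation (\<lambda>\<omega>. indicator ?E \<omega> * \<bar>X \<omega>\<bar>) / prob ?E"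
      by simp
    finally have "expectation (\<lambda>\<omega>. indicator ?E \<omega> * \<bar>X \<omega>\<bar>) \<le> prob ?E"
      using le pos by (simp add: divide_le_eq)
    then show ?thesis
      unfolding eq by linarith
  qed
qed

text \<open>On [0, 2] the function \<open>1 - x\<close> is odd about the midpoint 1, and likewise on
  the mirror image. This is the baseline of a constant density, against which a non-increasing one
  is compared.\<close>

lemma has_bochner_integral_truncated_1_minus_abs:
  "has_bochner_integral lborel (\<lambda>x::real. (1 - \<bar>x\<bar>) * indicator {..2} \<bar>x\<bar>) 0"
proof -
  have left: "has_bochner_integral lborel (\<lambda>x::real. (1 + x) * indicator {- 2..0} x)
      ((0 + 0\<^sup>2 / 2) - (- 2 + (- 2)\<^sup>2 / 2))"
    by (rule has_bochner_integral_FTC_Icc_real) (auto intro!: derivative_eq_intros)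
  have right: "has_bochner_integral lborel (\<lambda>x::real. (1 - x) * indicator {0..2} x)
      ((2 - 2\<^sup>2 / 2) - (0 - 0\<^sup>2 / 2))"
    by (rule has_bochner_integral_FTC_Icc_real) (auto intro!: derivative_eq_intros)
  have "has_bochner_integral lborel
      (\<lambda>x::real. (1 + x) * indicator {- 2..0} x + (1 - x) * indicator {0..2} x) 0"
    using has_bochner_integral_add[OF left right] by simp
  also have "?this \<longleftrightarrow> ?thesis"
  \<comment> \<open>Both closed pieces contain 0, so the functions differ there and agree only
    almost everywhere.\<close>
  proof (rule has_bochner_integral_cong_AE)
    have "(1 + x) * indicator {- 2..0} x + (1 - x) * indicator {0..2} x
        = (1 - \<bar>x\<bar>) * indicator {..2} \<bar>x\<bar>" if "x \<noteq> 0" for x :: real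
      using that by (cases "x > 0") (simp_all add: indicator_def abs_le_iff)
    then show "AE x in lborel. (1 + x) * indicator {- 2..0} x + (1 - x) * indicator {0..2} x
        = (1 - \<bar>x\<bar>) * indicator {..2} \<bar>x::real\<bar>"
      using AE_lborel_singleton[of "0::real"] by (auto elim: eventually_mono)
  qed measurable
  finally show ?thesis .
qed

text \<open>Chebyshev's argument: \<open>1 - \<bar>x\<bar>\<close> and \<open>p (x\<^sup>2) - p 1\<close> have the same sign.\<close>

lemma (in prob_space) truncated_mean_nonneg_of_antimono:
  fixes X :: "'a \<Rightarrow> real" and p :: "real \<Rightarrow> real"
  assumes X: "distributed M lborel X (\<lambda>x. ennreal (p (x\<^sup>2)))"
    and p_nonneg: "\<And>t. t \<ge> 0 \<Longrightarrow> p t \<ge> 0"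
    and p: "antimono_on {0<..} p"
  shows "0 \<le> expectation (\<lambda>\<omega>. (1 - \<bar>X \<omega>\<bar>) * indicator {..2} \<bar>X \<omega>\<bar>)"
proof -
  let ?\<phi> = "\<lambda>x::real. (1 - \<bar>x\<bar>) * indicator {..2} \<bar>x\<bar>"
  have [measurable]: "X \<in> borel_measurable M"
    using distributed_measurable[OF X] by simp
  have "0 = (\<integral>x. p 1 * ?\<phi> x \<partial>lborel)"
    using has_bochner_integral_truncated_1_minus_abs by (simp add: has_bochner_integral_iff)
  also have "\<dots> \<le> (\<integral>x. p (x\<^sup>2) * ?\<phi> x \<partial>lborel)"
  proof (rule integral_mono_AE)
    show "integrable lborel (\<lambda>x. p 1 * ?\<phi> x)"
      using has_bochner_integral_truncated_1_minus_abs by (simp add: has_bochner_integral_iff)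
    show "integrable lborel (\<lambda>x. p (x\<^sup>2) * ?\<phi> x)"
      using integrable_truncated_1_minus[of X] p_nonneg by (subst distributed_integrable[OF X]) auto
    \<comment> \<open>At the origin the argument \<open>x\<^sup>2\<close> is 0, outside the open
      half-line on which \<open>p\<close> is monotone.\<close>
    show "AE x in lborel. p 1 * ?\<phi> x \<le> p (x\<^sup>2) * ?\<phi> x"
      using AE_lborel_singleton[of "0::real"]
    proof eventually_elim
      fix x :: real
      assume x: "x \<noteq> 0"
      show "p 1 * ?\<phi> x \<le> p (x\<^sup>2) * ?\<phi> x"
      proof (cases "\<bar>x\<bar> \<le> 1")
        case True
        then have "p 1 \<le> p (x\<^sup>2)"
          using x by (intro monotone_onD[OF p, of "x\<^sup>2" 1, simplified]) (auto simp: abs_square_le_1)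
        with True show ?thesis by (intro mult_right_mono) auto
      next
        case False
        then have "p (x\<^sup>2) \<le> p 1"
          using x by (intro monotone_onD[OF p, of 1 "x\<^sup>2", simplified]) (auto simp: abs_square_less_1 simp flip: not_less)
        with False show ?thesis by (intro mult_right_mono_neg) (auto simp: indicator_def)
      qed
    qed
  qed
  also have "\<dots> = expectation (\<lambda>\<omega>. ?\<phi> (X \<omega>))"
    using p_nonneg by (intro distributed_integral[OF X]) auto
  finally show ?thesis .
qed

section \<open>Centring at the parameter, and optimality of the unit scale\<close>

lemma (in prob_space) distributed_centre:
  fixes X :: "'a \<Rightarrow> real" and f :: "real \<Rightarrow> ennreal"
  assumes "distributed M lborel X (\<lambda>x. f (x - \<theta>))"
  shows "distributed M lborel (\<lambda>\<omega>. X \<omega> - \<theta>) f"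
  using distributed_affine[OF assms, of 1 "- \<theta>"] by (simp add: divide_ennreal_def)

theorem theorem4:
  fixes p :: "real \<Rightarrow> real"
    and P :: "real \<Rightarrow> 'a measure"
    and X Y :: "'a \<Rightarrow> real"
  assumes p_nonneg: "\<And>t. t \<ge> 0 \<Longrightarrow> p t \<ge> 0"
    and prob: "\<And>\<theta>. prob_space (P \<theta>)"
    and X_dist: "\<And>\<theta>. distributed (P \<theta>) lborel X (\<lambda>x. ennreal (p (\<bar>x - \<theta>\<bar>\<^sup>2)))"
    and Y_dist: "\<And>\<theta>. distributed (P \<theta>) lborel Y (\<lambda>y. ennreal (target_density \<theta> y))"
    and indep: "\<And>\<theta>. prob_space.indep_var (P \<theta>) borel X borel Y"
    and cond: "(cond_expect_event (P 0) (\<lambda>\<omega>. \<bar>X \<omega>\<bar>) {\<omega> \<in> space (P 0). \<bar>X \<omega>\<bar> \<le> 2} \<le> 1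
                  \<and> (\<forall>s>0. p (s\<^sup>2) \<ge> p ((s + 2)\<^sup>2)))
               \<or> antimono_on {0<..} p"
  shows "optimal_scale P X 1"
proof -
  have X_centred: "distributed (P \<theta>) lborel (\<lambda>\<omega>. X \<omega> - \<theta>) (\<lambda>x. ennreal (p (x\<^sup>2)))" for \<theta>
    using prob_space.distributed_centre[OF prob, of \<theta> X "\<lambda>x. ennreal (p (x\<^sup>2))" \<theta>] X_dist[of \<theta>]
    by simp
  have X0: "distributed (P 0) lborel X (\<lambda>x. ennreal (p (x\<^sup>2)))"
    using X_centred[of 0] by simp
  have shift: "p ((x + 2)\<^sup>2) \<le> p (x\<^sup>2)" if "x > 0" for x
    using cond
  proof
    assume "antimono_on {0<..} p"
    then show ?thesis
      by (rule monotone_onD) (use that in \<open>auto intro!: power_mono\<close>)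
  qed (use that in auto)
  have mean0: "0 \<le> (LINT \<omega>|P 0. (1 - \<bar>X \<omega>\<bar>) * indicator {..2} \<bar>X \<omega>\<bar>)"
    using cond
  proof
    assume "antimono_on {0<..} p"
    then show ?thesis
      using prob_space.truncated_mean_nonneg_of_antimono[OF prob X0 p_nonneg] by blast
  next
    assume "cond_expect_event (P 0) (\<lambda>\<omega>. \<bar>X \<omega>\<bar>) {\<omega> \<in> space (P 0). \<bar>X \<omega>\<bar> \<le> 2} \<le> 1
      \<and> (\<forall>s>0. p (s\<^sup>2) \<ge> p ((s + 2)\<^sup>2))"
    then show ?thesis
      using prob_space.truncated_mean_nonneg_of_cond_expect[OF prob, of X 0] distributed_measurable[OF X0]
      by simp
  qed
  \<comment> \<open>The mean condition is known at parameter 0 only. Written against the centred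
    density, the truncated mean is the same for all \<open>\<theta>\<close>.\<close>
  have "(LINT \<omega>|P \<theta>. (1 - \<bar>X \<omega> - \<theta>\<bar>) * indicator {..2} \<bar>X \<omega> - \<theta>\<bar>)
      = (LINT x|lborel. p (x\<^sup>2) * ((1 - \<bar>x\<bar>) * indicator {..2} \<bar>x\<bar>))" for \<theta>
    using p_nonneg by (intro distributed_integral[OF X_centred, symmetric]) auto
  from this this[of 0] mean0
  have "0 \<le> (LINT \<omega>|P \<theta>. (1 - \<bar>X \<omega> - \<theta>\<bar>) * indicator {..2} \<bar>X \<omega> - \<theta>\<bar>)" for \<theta>
    by simp
  then show ?thesis
    unfolding optimal_scale_def risk_def
    using prob_space.risk_le[OF prob X_centred shift] by simp
qed

end
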